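(* Let $x\in 2^{\mathbb N}$ and let $f:[x]_{\equiv_T}\to 2^{\mathbb N}$ be uniformly Turing invariant. Then either $f(x)\ge_T x$ or $f$ is constant.
   Context: $\le_T$ and $\equiv_T$ denote Turing reducibility and Turing equivalence, and $[x]_{\equiv_T}=\{y\in 2^{\mathbb N}: y\equiv_T x\}$. $(\varphi_i^x)_{i\in\mathbb N}$ is the standard numbering of the partial unary computable-in-$x$ functions. For $x,y\in 2^{\mathbb N}$: $x\le_T y$ via $i$ means $x=\varphi_i^y$; and $x\equiv_T y$ via $(i,j)$ means $x\ge_T y$ via $i$ and $x\le_T y$ via $j$, i.e. $y=\varphi_i^x$ and $x=\varphi_j^y$. A function $f:A\to 2^{\mathbb N}$ with $A\subseteq 2^{\mathbb N}$ is uniformly Turing invariant (UTI) if there is a function $u:\mathbb N^2\to\mathbb N^2$ (not assumed computable) such that for all $x,y\in A$ and all $(i,j)\in\mathbb N^2$: $x\equiv_T y$ via $(i,j)$ implies $f(x)\equiv_T f(y)$ via $u(i,j)$. *)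

theory Defs
  imports "HOL-Library.Nat_Bijection"
begin

type_synonym cantor = "nat \<Rightarrow> bool"

text \<open>
  The functions computable in \<open>x\<close>, presented through unary functions only: tuples are
  coded by the pairing \<^const>\<open>prod_encode\<close>, with the two projections as basic functions, so
  that no arities are needed. These are Kleene's schemes of composition, primitive recursion and
  minimization, together with a scheme that queries the characteristic function of \<open>x\<close>.
\<close>

datatype prog =
    Zero
  | Succ
  | Fst
  | Snd
  | Query
  | Pair prog prog
  | Comp prog prog
  | Prec prog prog
  | Mu prog

primrec run :: "cantor \<Rightarrow> prog \<Rightarrow> nat \<Rightarrow> nat option" where
  "run x Zero = (\<lambda>n. Some 0)"
| "run x Succ = (\<lambda>n. Some (Suc n))"
| "run x Fst = (\<lambda>n. Some (fst (prod_decode n)))"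
| "run x Snd = (\<lambda>n. Some (snd (prod_decode n)))"
| "run x Query = (\<lambda>n. Some (of_bool (x n)))"
| "run x (Pair p q) =
    (\<lambda>n. Option.bind (run x p n) (\<lambda>a. Option.bind (run x q n) (\<lambda>b. Some (prod_encode (a, b)))))"
| "run x (Comp p q) = (\<lambda>n. Option.bind (run x q n) (run x p))"
| "run x (Prec p q) =
    (\<lambda>n. rec_nat (run x p (fst (prod_decode n)))
      (\<lambda>k r. Option.bind r (\<lambda>v. run x q (prod_encode (fst (prod_decode n), prod_encode (k, v)))))
      (snd (prod_decode n)))"
| "run x (Mu p) =
    (\<lambda>n. if \<exists>m. run x p (prod_encode (n, m)) = Some 0 \<and>
               (\<forall>k<m. \<exists>v>0. run x p (prod_encode (n, k)) = Some v)
         then Some (LEAST m. run x p (prod_encode (n, m)) = Some 0)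
         else None)"

primrec godel :: "prog \<Rightarrow> nat" where
  "godel Zero = 0"
| "godel Succ = 1"
| "godel Fst = 2"
| "godel Snd = 3"
| "godel Query = 4"
| "godel (Pair p q) = 5 + 4 * prod_encode (godel p, godel q)"
| "godel (Comp p q) = 6 + 4 * prod_encode (godel p, godel q)"
| "godel (Prec p q) = 7 + 4 * prod_encode (godel p, godel q)"
| "godel (Mu p) = 8 + 4 * godel p"

lemma inj_godel: "inj godel"
proof (rule injI)
  fix p q
  show "godel p = godel q \<Longrightarrow> p = q"
  proof (induction p arbitrary: q)
    case Zero then show ?case by (cases q) auto
  next
    case Succ then show ?case by (cases q) auto
  next
    case Fst then show ?case by (cases q) auto
  next
    case Snd then show ?case by (cases q) auto
  next
    case Query then show ?case by (cases q) auto
  next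
    case (Pair p1 p2) then show ?case by (cases q) (simp_all, presburger+)
  next
    case (Comp p1 p2) then show ?case by (cases q) (simp_all, presburger+)
  next
    case (Prec p1 p2) then show ?case by (cases q) (simp_all, presburger+)
  next
    case (Mu p) then show ?case by (cases q) (simp_all, presburger+)
  qed
qed

lemma surj_godel: "surj godel"
proof -
  have "\<exists>p. godel p = n" for n
  proof (induction n rule: less_induct)
    case (less n)
    show ?case
    proof (cases "n < 5")
      case True
      then consider "n = 0" | "n = 1" | "n = 2" | "n = 3" | "n = 4" by linarith
      then show ?thesis
        by cases (metis godel.simps(1), metis godel.simps(2), metis godel.simps(3),
            metis godel.simps(4), metis godel.simps(5))
    next
      case False
      define m where "m = (n - 5) div 4"
      obtain a b where ab: "m = prod_encode (a, b)" by (metis prod_decode_inverse surj_pair)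
      have m: "m < n" and n: "n = 5 + 4 * m \<or> n = 6 + 4 * m \<or> n = 7 + 4 * m \<or> n = 8 + 4 * m"
        using False unfolding m_def by presburger+
      have "a < n" "b < n"
        using m ab le_prod_encode_1[of a b] le_prod_encode_2[of b a] by linarith+
      with m obtain p q r where "godel p = a" "godel q = b" "godel r = m"
        using less by blast
      then show ?thesis
        using n ab by (metis godel.simps(6-9))
    qed
  qed
  then show ?thesis by (metis surjI)
qed

lemma bij_godel: "bij godel"
  using inj_godel surj_godel by (rule bijI)

definition phi :: "nat \<Rightarrow> cantor \<Rightarrow> nat \<Rightarrow> nat option" where
  "phi i x = run x (inv godel i)"

definition turing_le_via :: "cantor \<Rightarrow> cantor \<Rightarrow> nat \<Rightarrow> bool" where
  "turing_le_via x y i \<longleftrightarrow> phi i y = (\<lambda>n. Some (of_bool (x n)))"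

definition turing_le :: "cantor \<Rightarrow> cantor \<Rightarrow> bool"  (infix "\<le>\<^sub>T" 50) where
  "x \<le>\<^sub>T y \<longleftrightarrow> (\<exists>i. turing_le_via x y i)"

definition turing_equiv :: "cantor \<Rightarrow> cantor \<Rightarrow> bool"  (infix "\<equiv>\<^sub>T" 50) where
  "x \<equiv>\<^sub>T y \<longleftrightarrow> x \<le>\<^sub>T y \<and> y \<le>\<^sub>T x"

text \<open>The first index computes \<open>y\<close> from \<open>x\<close>, the second one \<open>x\<close> from \<open>y\<close>.\<close>

definition turing_equiv_via :: "cantor \<Rightarrow> cantor \<Rightarrow> nat \<times> nat \<Rightarrow> bool" where
  "turing_equiv_via x y ij \<longleftrightarrow> turing_le_via y x (fst ij) \<and> turing_le_via x y (snd ij)"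

definition turing_degree :: "cantor \<Rightarrow> cantor set" where
  "turing_degree x = {y. y \<equiv>\<^sub>T x}"

definition uniformly_turing_invariant_on :: "cantor set \<Rightarrow> (cantor \<Rightarrow> cantor) \<Rightarrow> bool" where
  "uniformly_turing_invariant_on A f \<longleftrightarrow>
    (\<exists>u :: nat \<times> nat \<Rightarrow> nat \<times> nat. \<forall>x\<in>A. \<forall>y\<in>A. \<forall>i j.
      turing_equiv_via x y (i, j) \<longrightarrow> turing_equiv_via (f x) (f y) (u (i, j)))"

end

theory Submission
  imports Defs
begin

text \<open>
  Suppose that \<open>f\<close> is not constant: \<open>f y \<noteq> f x\<close> for some \<open>y\<close> in the degree of \<open>x\<close>. Let
  \<open>tag z k\<close> be the join of \<open>z\<close> with \<open>{k}\<close>. To decode \<open>x k\<close> from \<open>f x\<close>, consider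
  the following path of sets inside the degree:
  \<open>x, tag x 0, tag x 1, \<dots>, tag x k, tag z k, tag z (k - 1), \<dots>, tag z 0\<close>, where
  \<open>z\<close> is \<open>y\<close> or \<open>x\<close> according to the bit \<open>x k\<close> (this is \<open>switch x y k\<close>). Each step
  of the path is one of a few kinds, and for each kind one and the same pair of indices witnesses the
  equivalence of the two ends, whatever \<open>k\<close> is. For the raising and lowering of the tag this is
  clear. For the middle step, \<open>k\<close> and \<open>x k\<close> can be read off \<open>tag x k\<close>; conversely,
  since \<open>x\<close> and \<open>y\<close> differ at some fixed position, looking there tells whether
  \<open>z\<close> is \<open>x\<close> or \<open>y\<close>, and \<open>x\<close> is then obtained by a fixed reduction
  (\<open>tag_switch_equivalent\<close>).

  Uniform invariance turns each kind of step into one fixed program for the images under \<open>f\<close>,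
  although the map on indices need not be computable: it is only evaluated at finitely many
  arguments. So \<open>f (tag z 0)\<close> is obtained from \<open>f x\<close> by running fixed programs along
  the path, each with the output of the previous one as its oracle. Now \<open>f (tag x 0)\<close> and
  \<open>f (tag y 0)\<close> differ at some place \<open>m\<close>, as they compute \<open>f x\<close> and \<open>f y\<close>
  by the same program, and the bit at \<open>m\<close> of \<open>f (tag z 0)\<close> reveals \<open>x k\<close>.

  It remains to see that the iteration along the path is computable uniformly in its length
  (\<open>iterate_reduction\<close>). A convergent computation uses finitely many oracle answers and
  finitely many steps. For a fixed program, evaluation with a table of oracle answers and a bound
  on searches is a total computable function of the table and the bound; it never errs on correct tables
  (\<open>bounded_run_sound\<close>) and succeeds when table and bound are large enough
  (\<open>bounded_run_complete\<close>). Hence one may compute tables for all sets of the chain with a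
  common bound, and raise the bound until the wanted bit appears.
\<close>

abbreviation pr :: "nat \<Rightarrow> nat \<Rightarrow> nat" where "pr a b \<equiv> prod_encode (a, b)"
abbreviation pfst :: "nat \<Rightarrow> nat" where "pfst n \<equiv> fst (prod_decode n)"
abbreviation psnd :: "nat \<Rightarrow> nat" where "psnd n \<equiv> snd (prod_decode n)"

section \<open>Uniform computability\<close>

text \<open>
  One program must work for every oracle of the family, with \<open>F i\<close> total; this is the uniformity
  that the theorem turns on. The index \<open>i\<close> itself is not an input of the program.
\<close>

definition computable_in :: "'i set \<Rightarrow> ('i \<Rightarrow> cantor) \<Rightarrow> ('i \<Rightarrow> nat \<Rightarrow> nat) \<Rightarrow> bool" where
  "computable_in A X F \<longleftrightarrow> (\<exists>p. \<forall>i\<in>A. \<forall>n. run (X i) p n = Some (F i n))"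

lemma computable_inI:
  "(\<And>i n. i \<in> A \<Longrightarrow> run (X i) p n = Some (F i n)) \<Longrightarrow> computable_in A X F"
  unfolding computable_in_def by blast

lemma computable_in_cong:
  assumes "computable_in A X F" "\<And>i n. i \<in> A \<Longrightarrow> F i n = G i n"
  shows "computable_in A X G"
  using assms unfolding computable_in_def by fastforce

lemma computable_in_id: "computable_in A X (\<lambda>i n. n)"
  by (rule computable_inI[where p = "Pair Fst Snd"]) simp

lemma computable_in_comp:
  assumes "computable_in A X F" "computable_in A X a"
  shows "computable_in A X (\<lambda>i n. F i (a i n))"
proof -
  obtain p q where "\<forall>i\<in>A. \<forall>n. run (X i) p n = Some (F i n)"
    and "\<forall>i\<in>A. \<forall>n. run (X i) q n = Some (a i n)"
    using assms unfolding computable_in_def by blast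
  then show ?thesis by (intro computable_inI[where p = "Comp p q"]) simp
qed

lemma computable_in_pair:
  assumes "computable_in A X a" "computable_in A X b"
  shows "computable_in A X (\<lambda>i n. pr (a i n) (b i n))"
proof -
  obtain p q where "\<forall>i\<in>A. \<forall>n. run (X i) p n = Some (a i n)"
    and "\<forall>i\<in>A. \<forall>n. run (X i) q n = Some (b i n)"
    using assms unfolding computable_in_def by blast
  then show ?thesis by (intro computable_inI[where p = "Pair p q"]) simp
qed

lemma computable_in_fst:
  assumes "computable_in A X a" shows "computable_in A X (\<lambda>i n. pfst (a i n))"
  by (rule computable_in_comp[OF _ assms]) (rule computable_inI[where p = Fst], simp)

lemma computable_in_snd:
  assumes "computable_in A X a" shows "computable_in A X (\<lambda>i n. psnd (a i n))"
  by (rule computable_in_comp[OF _ assms]) (rule computable_inI[where p = Snd], simp)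

lemma computable_in_Suc:
  assumes "computable_in A X a" shows "computable_in A X (\<lambda>i n. Suc (a i n))"
  by (rule computable_in_comp[OF _ assms]) (rule computable_inI[where p = Succ], simp)

lemma computable_in_query:
  assumes "computable_in A X a" shows "computable_in A X (\<lambda>i n. of_bool (X i (a i n)))"
  by (rule computable_in_comp[OF _ assms]) (rule computable_inI[where p = Query], simp)

lemma computable_in_const: "computable_in A X (\<lambda>i n. c)"
proof (induction c)
  case 0 show ?case by (rule computable_inI[where p = Zero]) simp
next
  case (Suc c) then show ?case by (rule computable_in_Suc)
qed

lemma computable_in_rec_nat:
  assumes "computable_in A X b" "computable_in A X c"
    and "computable_in A X (\<lambda>i m. s i (pfst m) (pfst (psnd m)) (psnd (psnd m)))"
  shows "computable_in A X (\<lambda>i n. rec_nat (b i n) (s i n) (c i n))"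
proof -
  obtain p q where p: "\<forall>i\<in>A. \<forall>n. run (X i) p n = Some (b i n)"
    and q: "\<forall>i\<in>A. \<forall>n. run (X i) q n = Some (s i (pfst n) (pfst (psnd n)) (psnd (psnd n)))"
    using assms unfolding computable_in_def by metis
  have "run (X i) (Prec p q) m = Some (rec_nat (b i (pfst m)) (s i (pfst m)) (psnd m))"
    if "i \<in> A" for i m
  proof -
    have "rec_nat (run (X i) p a)
        (\<lambda>k r. Option.bind r (\<lambda>v. run (X i) q (pr a (pr k v)))) j = Some (rec_nat (b i a) (s i a) j)"
      for a j using p q that by (induction j) auto
    then show ?thesis by simp
  qed
  then have "computable_in A X (\<lambda>i m. rec_nat (b i (pfst m)) (s i (pfst m)) (psnd m))"
    by (rule computable_inI)
  from computable_in_comp[OF this computable_in_pair[OF computable_in_id assms(2)]]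
  show ?thesis by simp
qed

lemma computable_in_case_nat:
  assumes "computable_in A X b" "computable_in A X c"
    and "computable_in A X (\<lambda>i m. s i (pfst m) (psnd m))"
  shows "computable_in A X (\<lambda>i n. case c i n of 0 \<Rightarrow> b i n | Suc v \<Rightarrow> s i n v)"
proof -
  have "computable_in A X (\<lambda>i m. (\<lambda>i m. s i (pfst m) (psnd m)) i (pr (pfst m) (pfst (psnd m))))"
    by (rule computable_in_comp[OF assms(3)])
      (intro computable_in_pair computable_in_fst computable_in_snd computable_in_id)
  then have "computable_in A X (\<lambda>i n. rec_nat (b i n) (\<lambda>k _. s i n k) (c i n))"
    by (intro computable_in_rec_nat assms(1,2)) simp
  then show ?thesis
    by (rule computable_in_cong) (simp split: nat.split)
qed

lemmas computable_in_intros =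
  computable_in_const computable_in_id computable_in_pair computable_in_fst computable_in_snd
  computable_in_Suc computable_in_query computable_in_rec_nat computable_in_case_nat

lemma computable_in_diff:
  assumes "computable_in A X a" "computable_in A X b"
  shows "computable_in A X (\<lambda>i n. a i n - b i n)"
proof -
  have rec: "rec_nat m (\<lambda>_ r. case r of 0 \<Rightarrow> 0 | Suc v \<Rightarrow> v) k = m - k" for m k :: nat
    by (induction k) (auto split: nat.split)
  have "computable_in A X
      (\<lambda>i n. rec_nat (a i n) (\<lambda>_ r. case r of 0 \<Rightarrow> 0 | Suc v \<Rightarrow> v) (b i n))"
    by (intro computable_in_intros assms)
  then show ?thesis unfolding rec .
qed

lemma computable_in_least:
  assumes "computable_in A X (\<lambda>i m. F i (pfst m) (psnd m))"
    and "\<And>i n. i \<in> A \<Longrightarrow> \<exists>m. F i n m = 0"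
  shows "computable_in A X (\<lambda>i n. LEAST m. F i n m = 0)"
proof -
  obtain p where p: "\<forall>i\<in>A. \<forall>n. run (X i) p n = Some (F i (pfst n) (psnd n))"
    using assms(1) unfolding computable_in_def by blast
  have "run (X i) (Mu p) n = Some (LEAST m. F i n m = 0)" if "i \<in> A" for i n
  proof -
    let ?m = "LEAST m. F i n m = 0"
    have "F i n ?m = 0" using assms(2)[OF that] by (rule LeastI_ex)
    moreover have "\<forall>k<?m. F i n k > 0" using not_less_Least by blast
    ultimately have "\<exists>m. F i n m = 0 \<and> (\<forall>k<m. F i n k > 0)" by blast
    then show ?thesis using p that by simp
  qed
  then show ?thesis by (rule computable_inI)
qed

text \<open>
  Primitive recursion on the truth value of the test evaluates its base case in any event, so the
  guarded program, which may diverge if the test fails, is placed in the step.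
\<close>

lemma computable_in_guard:
  assumes "computable_in A X (\<lambda>i n. of_bool (T i))" and "computable_in {i\<in>A. T i} X F"
  shows "computable_in A X (\<lambda>i n. if T i then F i n else 0)"
proof -
  obtain t p where t: "\<forall>i\<in>A. \<forall>n. run (X i) t n = Some (of_bool (T i))"
    and p: "\<forall>i\<in>{i\<in>A. T i}. \<forall>n. run (X i) p n = Some (F i n)"
    using assms unfolding computable_in_def by blast
  show ?thesis
    using t p
    by (intro computable_inI[where p = "Comp (Prec Zero (Comp p Fst)) (Pair (Pair Fst Snd) t)"]) auto
qed

text \<open>
  Each branch is computable only on the part of the family where it is selected, as happens with a
  reduction that is meaningful for one particular oracle. Both branches are first made total by
  guarding them; then it is harmless to evaluate them both.
\<close>

lemma computable_in_cases:
  assumes T: "computable_in A X (\<lambda>i n. of_bool (T i))"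
    and F: "computable_in {i\<in>A. T i} X F" and G: "computable_in {i\<in>A. \<not> T i} X G"
  shows "computable_in A X (\<lambda>i n. if T i then F i n else G i n)"
proof -
  have "computable_in A X (\<lambda>i n. 1 - of_bool (T i))"
    by (intro computable_in_diff computable_in_intros T)
  then have "computable_in A X (\<lambda>i n. of_bool (\<not> T i))"
    by (rule computable_in_cong) simp
  then have G': "computable_in A X (\<lambda>i n. if \<not> T i then G i n else 0)"
    using G by (rule computable_in_guard)
  have "computable_in A X (\<lambda>i n. case of_bool (T i) of
      0 \<Rightarrow> (if \<not> T i then G i n else 0) | Suc v \<Rightarrow> (if T i then F i n else 0))"
    using computable_in_comp[OF computable_in_guard[OF T F] computable_in_fst[OF computable_in_id]]
    by (intro computable_in_case_nat T G')
  then show ?thesis by (rule computable_in_cong) simp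
qed

section \<open>Substituting a computation for the oracle\<close>

text \<open>
  The oracle to be substituted may depend on a parameter \<open>k\<close>, supplied with the input:
  \<open>psubst r p\<close> carries \<open>k\<close> along in the first component of every input and
  answers a query at \<open>n\<close> by running \<open>r\<close> on \<open>(k, n)\<close>. The pairings
  in the last two clauses bring \<open>((k, a), b)\<close> into the form \<open>(k, (a, b))\<close>.
\<close>

primrec psubst :: "prog \<Rightarrow> prog \<Rightarrow> prog" where
  "psubst r Zero = Zero"
| "psubst r Succ = Comp Succ Snd"
| "psubst r Fst = Comp Fst Snd"
| "psubst r Snd = Comp Snd Snd"
| "psubst r Query = r"
| "psubst r (Pair p q) = Pair (psubst r p) (psubst r q)"
| "psubst r (Comp p q) = Comp (psubst r p) (Pair Fst (psubst r q))"
| "psubst r (Prec p q) =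
    Comp (Prec (psubst r p) (Comp (psubst r q) (Pair (Comp Fst Fst) (Pair (Comp Snd Fst) Snd))))
      (Pair (Pair Fst (Comp Fst Snd)) (Comp Snd Snd))"
| "psubst r (Mu p) = Mu (Comp (psubst r p) (Pair (Comp Fst Fst) (Pair (Comp Snd Fst) Snd)))"

lemma run_psubst:
  assumes "\<And>n. run X r (pr k n) = Some (of_bool (Y n))"
  shows "run X (psubst r p) (pr k n) = run Y p n"
proof (induction p arbitrary: n)
  case (Prec p q)
  show ?case by (simp add: Prec.IH)
next
  case (Mu p)
  show ?case by (simp add: Mu.IH)
qed (simp_all add: assms)

lemma computable_in_trans:
  assumes "computable_in A X (\<lambda>i n. of_bool (Y i n))" "computable_in A Y F"
  shows "computable_in A X F"
proof -
  obtain r p where r: "\<forall>i\<in>A. \<forall>n. run (X i) r n = Some (of_bool (Y i n))"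
    and p: "\<forall>i\<in>A. \<forall>n. run (Y i) p n = Some (F i n)"
    using assms unfolding computable_in_def by blast
  have "run (X i) (Comp (psubst (Comp r Snd) p) (Pair Zero (Pair Fst Snd))) n = Some (F i n)"
    if "i \<in> A" for i n
    using run_psubst[of "X i" "Comp r Snd" 0 "Y i" p n] r p that by simp
  then show ?thesis by (rule computable_inI)
qed

section \<open>Evaluation from finitely many oracle answers\<close>

text \<open>
  A table of length \<open>s\<close> is a list, coded by iterated pairing with \<open>0\<close> as the empty
  list. Since \<open>0\<close> decodes to \<open>(0, 0)\<close>, every entry beyond the end reads as \<open>0\<close>.
  Entries follow the convention that \<open>0\<close> means undefined and \<open>Suc v\<close> means the value
  \<open>v\<close>.
\<close>

definition lookup :: "nat \<Rightarrow> nat \<Rightarrow> nat" where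
  "lookup c i = pfst (rec_nat c (\<lambda>_. psnd) i)"

definition tabulate :: "nat \<Rightarrow> (nat \<Rightarrow> nat) \<Rightarrow> nat" where
  "tabulate s F = rec_nat 0 (\<lambda>j c. pr (F (s - Suc j)) c) s"

lemma lookup_tabulate: "lookup (tabulate s F) i = (if i < s then F i else 0)"
proof -
  let ?c = "rec_nat 0 (\<lambda>j c. pr (F (s - Suc j)) c)"
  have tl0: "rec_nat 0 (\<lambda>_. psnd) i = 0" for i
    by (induction i) (auto simp: prod_decode_def prod_decode_aux.simps)
  have tl: "rec_nat c (\<lambda>_. psnd) (Suc i) = rec_nat (psnd c) (\<lambda>_. psnd) i" for c i
    by (induction i) auto
  have "lookup (?c j) i = (if i < j then F (s - j + i) else 0)" if "j \<le> s" for j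
    using that
  proof (induction j arbitrary: i)
    case 0
    show ?case by (simp add: lookup_def tl0) (simp add: prod_decode_def prod_decode_aux.simps)
  next
    case (Suc j)
    show ?case
    proof (cases i)
      case 0 then show ?thesis by (simp add: lookup_def)
    next
      case (Suc i')
      have "lookup (?c (Suc j)) i = lookup (?c j) i'"
        unfolding Suc lookup_def tl by simp
      moreover have "s - j + i' = s - Suc j + i" using Suc Suc.prems by simp
      ultimately show ?thesis using Suc.IH[of i'] Suc.prems Suc by simp
    qed
  qed
  from this[of s] show ?thesis unfolding tabulate_def by simp
qed

lemma computable_in_lookup:
  assumes "computable_in A X a" "computable_in A X b"
  shows "computable_in A X (\<lambda>i n. lookup (a i n) (b i n))"
  unfolding lookup_def by (intro computable_in_intros assms)

lemma computable_in_tabulate: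
  assumes s: "computable_in A X s" and F: "computable_in A X (\<lambda>i m. F i (pfst m) (psnd m))"
  shows "computable_in A X (\<lambda>i n. tabulate (s i n) (F i n))"
proof -
  have "computable_in A X (\<lambda>i m. (\<lambda>i m. F i (pfst m) (psnd m)) i
      (pr (pfst m) (s i (pfst m) - Suc (pfst (psnd m)))))"
    by (rule computable_in_comp[OF F])
      (intro computable_in_intros computable_in_diff computable_in_comp[OF s])
  then have "computable_in A X (\<lambda>i m. F i (pfst m) (s i (pfst m) - Suc (pfst (psnd m))))"
    by simp
  then show ?thesis
    unfolding tabulate_def by (intro computable_in_intros s)
qed

text \<open>
  Evaluation that takes the oracle answers from the table \<open>c\<close> and searches below \<open>s\<close>
  only; \<open>0\<close> means undefined and \<open>Suc v\<close> means the value \<open>v\<close>. Because of this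
  convention the table entry itself is the result of a query. The state of a bounded search is
  \<open>0\<close> while it goes on, \<open>1\<close> after it met an undefined value, and \<open>m + 2\<close> once it
  found the zero \<open>m\<close>, so that subtracting \<open>1\<close> yields the result.
\<close>

primrec bounded_run :: "nat \<Rightarrow> nat \<Rightarrow> prog \<Rightarrow> nat \<Rightarrow> nat" where
  "bounded_run s c Zero n = 1"
| "bounded_run s c Succ n = Suc (Suc n)"
| "bounded_run s c Fst n = Suc (pfst n)"
| "bounded_run s c Snd n = Suc (psnd n)"
| "bounded_run s c Query n = lookup c n"
| "bounded_run s c (Pair p q) n = (case bounded_run s c p n of 0 \<Rightarrow> 0 | Suc a \<Rightarrow>
    (case bounded_run s c q n of 0 \<Rightarrow> 0 | Suc b \<Rightarrow> Suc (pr a b)))"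
| "bounded_run s c (Comp p q) n = (case bounded_run s c q n of 0 \<Rightarrow> 0 | Suc b \<Rightarrow> bounded_run s c p b)"
| "bounded_run s c (Prec p q) n = rec_nat (bounded_run s c p (pfst n))
    (\<lambda>k r. case r of 0 \<Rightarrow> 0 | Suc v \<Rightarrow> bounded_run s c q (pr (pfst n) (pr k v))) (psnd n)"
| "bounded_run s c (Mu p) n = rec_nat 0
    (\<lambda>m r. case r of 0 \<Rightarrow>
        (case bounded_run s c p (pr n m) of 0 \<Rightarrow> 1 | Suc v \<Rightarrow> (case v of 0 \<Rightarrow> Suc (Suc m) | Suc w \<Rightarrow> 0))
      | Suc v \<Rightarrow> Suc v) s - 1"

lemma computable_in_bounded_run:
  assumes "computable_in A X s" "computable_in A X c" "computable_in A X a"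
  shows "computable_in A X (\<lambda>i n. bounded_run (s i n) (c i n) p (a i n))"
  using assms
proof (induction p arbitrary: s c a)
  case (Prec p q)
  show ?case unfolding bounded_run.simps
    by (intro computable_in_intros Prec.IH computable_in_comp[OF Prec.prems(1)]
      computable_in_comp[OF Prec.prems(2)] computable_in_comp[OF Prec.prems(3)] Prec.prems)
next
  case (Mu p)
  show ?case unfolding bounded_run.simps
    by (intro computable_in_diff computable_in_intros Mu.IH computable_in_comp[OF Mu.prems(1)]
      computable_in_comp[OF Mu.prems(2)] computable_in_comp[OF Mu.prems(3)] Mu.prems)
next
  case (Pair p q)
  show ?case unfolding bounded_run.simps
    by (intro computable_in_intros Pair.IH computable_in_comp[OF Pair.prems(1)]
      computable_in_comp[OF Pair.prems(2)] computable_in_comp[OF Pair.prems(3)] Pair.prems)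
next
  case (Comp p q)
  show ?case unfolding bounded_run.simps
    by (intro computable_in_intros Comp.IH computable_in_comp[OF Comp.prems(1)]
      computable_in_comp[OF Comp.prems(2)] computable_in_comp[OF Comp.prems(3)] Comp.prems)
next
  case Query
  then show ?case unfolding bounded_run.simps by (intro computable_in_lookup)
qed (unfold bounded_run.simps, (intro computable_in_intros; assumption)+)


abbreviation search_step :: "nat \<Rightarrow> nat \<Rightarrow> prog \<Rightarrow> nat \<Rightarrow> nat \<Rightarrow> nat \<Rightarrow> nat" where
  "search_step s c p n m r \<equiv> (case r of 0 \<Rightarrow>
        (case bounded_run s c p (pr n m) of 0 \<Rightarrow> 1 | Suc v \<Rightarrow> (case v of 0 \<Rightarrow> Suc (Suc m) | Suc w \<Rightarrow> 0))
      | Suc v \<Rightarrow> Suc v)"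

text \<open>
  The table may be incomplete but not wrong. For a search, the invariant is that all values before the
  current position, or before the zero that was found, are defined and positive.
\<close>

lemma bounded_run_sound:
  assumes consistent: "\<And>i. lookup c i \<noteq> 0 \<Longrightarrow> lookup c i = Suc (of_bool (Y i))"
  shows "bounded_run s c p n = Suc v \<Longrightarrow> run Y p n = Some v"
proof (induction p arbitrary: n v)
  case Query
  then show ?case using consistent[of n] by simp
next
  case (Pair p q)
  then show ?case by (auto split: nat.splits)
next
  case (Comp p q)
  then show ?case by (auto split: nat.splits)
next
  case (Prec p q)
  have "rec_nat (bounded_run s c p a)
      (\<lambda>k r. case r of 0 \<Rightarrow> 0 | Suc v \<Rightarrow> bounded_run s c q (pr a (pr k v))) j = Suc v \<Longrightarrow>
    rec_nat (run Y p a) (\<lambda>k r. Option.bind r (\<lambda>v. run Y q (pr a (pr k v)))) j = Some v" for a j v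
    by (induction j arbitrary: v) (auto split: nat.splits simp: Prec.IH)
  with Prec.prems show ?case by simp
next
  case (Mu p)
  let ?st = "\<lambda>M. rec_nat 0 (search_step s c p n) M"
  have inv: "(?st M = 0 \<longrightarrow> (\<forall>k<M. \<exists>w. bounded_run s c p (pr n k) = Suc (Suc w))) \<and>
     (\<forall>m. ?st M = Suc (Suc m) \<longrightarrow> bounded_run s c p (pr n m) = Suc 0 \<and>
        (\<forall>k<m. \<exists>w. bounded_run s c p (pr n k) = Suc (Suc w)))" for M
  proof (induction M)
    case (Suc M)
    then show ?case
      by (auto split: nat.split simp: less_Suc_eq)
  qed simp
  have "?st s = Suc (Suc v)" using Mu.prems by simp
  with inv have v: "bounded_run s c p (pr n v) = Suc 0"
    and less: "\<And>k. k < v \<Longrightarrow> \<exists>w. bounded_run s c p (pr n k) = Suc (Suc w)" by blast+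
  have zero: "run Y p (pr n v) = Some 0" using v by (rule Mu.IH)
  have pos: "\<exists>w>0. run Y p (pr n k) = Some w" if "k < v" for k
    using less[OF that] Mu.IH by blast
  have "(LEAST m. run Y p (pr n m) = Some 0) = v"
  proof (rule Least_equality)
    show "run Y p (pr n v) = Some 0" by (rule zero)
  next
    fix m assume "run Y p (pr n m) = Some 0"
    then show "v \<le> m" using pos[of m] by (cases "m < v") auto
  qed
  moreover have "\<exists>m. run Y p (pr n m) = Some 0 \<and> (\<forall>k<m. \<exists>w>0. run Y p (pr n k) = Some w)"
    using zero pos by blast
  ultimately show ?case by simp
qed simp_all

definition agrees_below :: "nat \<Rightarrow> nat \<Rightarrow> cantor \<Rightarrow> bool" where
  "agrees_below N c Y \<longleftrightarrow> (\<forall>i<N. lookup c i = Suc (of_bool (Y i)))"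

lemma agrees_below_antimono: "agrees_below N c Y \<Longrightarrow> M \<le> N \<Longrightarrow> agrees_below M c Y"
  unfolding agrees_below_def by auto

lemma agrees_below_max:
  "agrees_below (max M N) c Y \<longleftrightarrow> agrees_below M c Y \<and> agrees_below N c Y"
  by (auto simp: agrees_below_def less_max_iff_disj)

text \<open>
  This is the use principle: a convergent computation asks finitely many questions and performs
  finitely many searches, so \<open>N\<close> is a maximum of finitely many bounds for its parts.
\<close>

lemma bounded_run_complete:
  "run Y p n = Some v \<Longrightarrow> \<exists>N. \<forall>s\<ge>N. \<forall>c. agrees_below N c Y \<longrightarrow> bounded_run s c p n = Suc v"
proof (induction p arbitrary: n v)
  case Query
  then show ?case by (intro exI[of _ "Suc n"]) (auto simp: agrees_below_def)
next
  case (Pair p q)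
  then obtain a b where ab: "run Y p n = Some a" "run Y q n = Some b" "v = pr a b"
    by (auto simp: bind_eq_Some_conv)
  from Pair.IH(1)[OF ab(1)] Pair.IH(2)[OF ab(2)] obtain M N where
    "\<forall>s\<ge>M. \<forall>c. agrees_below M c Y \<longrightarrow> bounded_run s c p n = Suc a"
    "\<forall>s\<ge>N. \<forall>c. agrees_below N c Y \<longrightarrow> bounded_run s c q n = Suc b" by blast
  then show ?case
    by (intro exI[of _ "max M N"]) (simp add: ab agrees_below_max)
next
  case (Comp p q)
  then obtain b where b: "run Y q n = Some b" "run Y p b = Some v"
    by (auto simp: bind_eq_Some_conv)
  from Comp.IH(2)[OF b(1)] Comp.IH(1)[OF b(2)] obtain M N where
    "\<forall>s\<ge>M. \<forall>c. agrees_below M c Y \<longrightarrow> bounded_run s c q n = Suc b"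
    "\<forall>s\<ge>N. \<forall>c. agrees_below N c Y \<longrightarrow> bounded_run s c p b = Suc v" by blast
  then show ?case
    by (intro exI[of _ "max M N"]) (simp add: agrees_below_max)
next
  case (Prec p q)
  have "\<exists>N. \<forall>s\<ge>N. \<forall>c. agrees_below N c Y \<longrightarrow> rec_nat (bounded_run s c p a)
      (\<lambda>k r. case r of 0 \<Rightarrow> 0 | Suc v \<Rightarrow> bounded_run s c q (pr a (pr k v))) j = Suc v"
    if "rec_nat (run Y p a) (\<lambda>k r. Option.bind r (\<lambda>v. run Y q (pr a (pr k v)))) j = Some v" for a j v
    using that
  proof (induction j arbitrary: v)
    case 0
    then show ?case using Prec.IH(1) by simp
  next
    case (Suc j)
    then obtain w where w: "rec_nat (run Y p a)
        (\<lambda>k r. Option.bind r (\<lambda>v. run Y q (pr a (pr k v)))) j = Some w"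
      "run Y q (pr a (pr j w)) = Some v" by (auto simp: bind_eq_Some_conv)
    from Suc.IH[OF w(1)] Prec.IH(2)[OF w(2)] obtain M N where
      "\<forall>s\<ge>M. \<forall>c. agrees_below M c Y \<longrightarrow> rec_nat (bounded_run s c p a)
        (\<lambda>k r. case r of 0 \<Rightarrow> 0 | Suc v \<Rightarrow> bounded_run s c q (pr a (pr k v))) j = Suc w"
      "\<forall>s\<ge>N. \<forall>c. agrees_below N c Y \<longrightarrow> bounded_run s c q (pr a (pr j w)) = Suc v" by blast
    then show ?case
      by (intro exI[of _ "max M N"]) (simp add: agrees_below_max)
  qed
  from this[of "pfst n" "psnd n" v] Prec.prems show ?case by simp
next
  case (Mu p)
  then obtain m where m: "run Y p (pr n m) = Some 0"
    "\<forall>k<m. \<exists>w>0. run Y p (pr n k) = Some w"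
    and v: "v = (LEAST m. run Y p (pr n m) = Some 0)"
    by (auto split: if_splits)
  have "v = m" unfolding v
  proof (rule Least_equality)
    show "run Y p (pr n m) = Some 0" by (rule m(1))
  next
    fix k assume "run Y p (pr n k) = Some 0"
    then show "m \<le> k" using m(2) by (cases "k < m") auto
  qed
  obtain w where w: "\<And>k. k \<le> m \<Longrightarrow> run Y p (pr n k) = Some (w k)"
    and pos: "\<And>k. k < m \<Longrightarrow> w k > 0" and "w m = 0"
  proof
    show "run Y p (pr n k) = Some (the (run Y p (pr n k)))" if "k \<le> m" for k
    proof -
      have "\<exists>w. run Y p (pr n k) = Some w"
        using m that by (cases "k = m") (simp, metis le_neq_implies_less)
      then show ?thesis by auto
    qed
    show "0 < the (run Y p (pr n k))" if "k < m" for k using m(2) that by auto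
    show "the (run Y p (pr n m)) = 0" using m(1) by simp
  qed
  from Mu.IH[OF w] obtain N where
    N: "\<And>k s c. k \<le> m \<Longrightarrow> s \<ge> N k \<Longrightarrow> agrees_below (N k) c Y \<Longrightarrow> bounded_run s c p (pr n k) = Suc (w k)"
    by metis
  define B where "B = max (Suc m) (Max (N ` {..m}))"
  have "bounded_run s c (Mu p) n = Suc v" if "s \<ge> B" "agrees_below B c Y" for s c
  proof -
    have "N k \<le> B" if "k \<le> m" for k
      unfolding B_def using that by (simp add: le_max_iff_disj)
    then have e: "bounded_run s c p (pr n k) = Suc (w k)" if "k \<le> m" for k
      using N[OF that] \<open>s \<ge> B\<close> \<open>agrees_below B c Y\<close> that
      by (meson agrees_below_antimono order_trans)
    let ?st = "\<lambda>M. rec_nat 0 (search_step s c p n) M"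
    have "?st M = 0" if "M \<le> m" for M
      using that
    proof (induction M)
      case (Suc M)
      then show ?case using e[of M] pos[of M] by (auto split: nat.split)
    qed simp
    then have "?st (Suc m) = Suc (Suc m)" using e[of m] \<open>w m = 0\<close> by simp
    then have "?st (Suc m + d) = Suc (Suc m)" for d by (induction d) auto
    from this[of "s - Suc m"] have "?st (Suc m + (s - Suc m)) = Suc (Suc m)" .
    moreover have "Suc m + (s - Suc m) = s" using \<open>s \<ge> B\<close> by (simp add: B_def)
    ultimately have "?st s = Suc (Suc m)" by (simp only:)
    then show ?thesis using \<open>v = m\<close> by simp
  qed
  then show ?case by blast
qed auto

section \<open>Iterating a reduction\<close>

text \<open>
  If \<open>p\<close> computes each \<open>G (Suc j)\<close> from \<open>G j\<close>, and \<open>X = G 0\<close>,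
  this is the table for \<open>G k\<close> that arises when all computations along the chain are bounded
  by \<open>s\<close>.
\<close>

definition approx_chain :: "prog \<Rightarrow> cantor \<Rightarrow> nat \<Rightarrow> nat \<Rightarrow> nat" where
  "approx_chain p X s k =
    rec_nat (tabulate s (\<lambda>i. Suc (of_bool (X i)))) (\<lambda>_ c. tabulate s (bounded_run s c p)) k"

lemma computable_in_approx_chain:
  assumes "computable_in A X s" "computable_in A X k"
  shows "computable_in A X (\<lambda>i n. approx_chain p (X i) (s i n) (k i n))"
  unfolding approx_chain_def
  by (intro computable_in_intros computable_in_tabulate computable_in_bounded_run assms
      computable_in_comp[OF assms(1)])

lemma approx_chain_sound:
  assumes step: "\<forall>j<k. \<forall>n. run (G j) p n = Some (of_bool (G (Suc j) n))"
  shows "lookup (approx_chain p (G 0) s k) n \<noteq> 0 \<Longrightarrow>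
    lookup (approx_chain p (G 0) s k) n = Suc (of_bool (G k n))"
  using step
proof (induction k arbitrary: n)
  case 0
  then show ?case by (simp add: approx_chain_def lookup_tabulate split: if_splits)
next
  case (Suc k)
  let ?c = "approx_chain p (G 0) s k"
  have c: "approx_chain p (G 0) s (Suc k) = tabulate s (bounded_run s ?c p)"
    by (simp add: approx_chain_def)
  from Suc.prems(1) obtain v where "n < s" and v: "bounded_run s ?c p n = Suc v"
    unfolding c lookup_tabulate by (metis not0_implies_Suc)
  have "run (G k) p n = Some v"
    using Suc.IH Suc.prems(2) by (intro bounded_run_sound[OF _ v]) simp
  with Suc.prems(2) \<open>n < s\<close> v show ?case unfolding c lookup_tabulate by simp
qed

text \<open>
  By induction along the chain: the first \<open>L\<close> bits of \<open>G (Suc k)\<close> use only finitely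
  many bits of \<open>G k\<close>.
\<close>

lemma approx_chain_complete:
  assumes step: "\<forall>j<k. \<forall>n. run (G j) p n = Some (of_bool (G (Suc j) n))"
  shows "\<exists>N. \<forall>s\<ge>N. agrees_below L (approx_chain p (G 0) s k) (G k)"
  using step
proof (induction k arbitrary: L)
  case 0
  show ?case by (auto simp: approx_chain_def agrees_below_def lookup_tabulate intro!: exI[of _ L])
next
  case (Suc k)
  have "run (G k) p n = Some (of_bool (G (Suc k) n))" for n using Suc.prems by blast
  from bounded_run_complete[OF this] obtain N where
    N: "\<And>n s c. s \<ge> N n \<Longrightarrow> agrees_below (N n) c (G k) \<Longrightarrow> bounded_run s c p n = Suc (of_bool (G (Suc k) n))"
    by metis
  define M where "M = Max (insert 0 (N ` {..<L}))"
  have M: "N n \<le> M" if "n < L" for n unfolding M_def using that by simp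
  obtain K where K: "\<forall>s\<ge>K. agrees_below M (approx_chain p (G 0) s k) (G k)"
    using Suc.IH[of M] Suc.prems by auto
  have "agrees_below L (approx_chain p (G 0) s (Suc k)) (G (Suc k))" if "s \<ge> max K (max M L)" for s
  proof -
    have c: "approx_chain p (G 0) s (Suc k) = tabulate s (bounded_run s (approx_chain p (G 0) s k) p)"
      by (simp add: approx_chain_def)
    have "lookup (approx_chain p (G 0) s (Suc k)) n = Suc (of_bool (G (Suc k) n))" if "n < L" for n
    proof -
      have "bounded_run s (approx_chain p (G 0) s k) p n = Suc (of_bool (G (Suc k) n))"
        using M[OF that] K \<open>s \<ge> max K (max M L)\<close>
        by (intro N) (auto intro: agrees_below_antimono)
      then show ?thesis
        using that \<open>s \<ge> max K (max M L)\<close> unfolding c lookup_tabulate by simp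
    qed
    then show ?thesis unfolding agrees_below_def by blast
  qed
  then show ?case by blast
qed

text \<open>
  The program raises the bound until the table for \<open>G k\<close> has an entry at \<open>n\<close>. Only
  the first \<open>k\<close> links of the chain are assumed, as chains that descend to a last set are
  considered below.
\<close>

lemma iterate_reduction:
  "\<exists>P. \<forall>G k n. (\<forall>j<k. \<forall>n. run (G j) p n = Some (of_bool (G (Suc j) n))) \<longrightarrow>
    run (G 0) P (pr k n) = Some (of_bool (G k n))"
proof -
  let ?value = "\<lambda>X m. lookup (approx_chain p X (psnd m) (pfst (pfst m))) (psnd (pfst m))"
  have val: "computable_in UNIV (\<lambda>X. X) ?value"
    by (intro computable_in_lookup computable_in_approx_chain computable_in_intros)
  \<comment> \<open>Zero precisely when the entry is defined, as minimization requires.\<close>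
  have "computable_in UNIV (\<lambda>X. X) (\<lambda>X m. 1 - ?value X m)"
    by (intro computable_in_diff computable_in_const val)
  then obtain t where t: "\<And>X m. run X t m = Some (1 - ?value X m)"
    unfolding computable_in_def by auto
  have "computable_in UNIV (\<lambda>X. X) (\<lambda>X m. ?value X m - 1)"
    by (intro computable_in_diff computable_in_const val)
  then obtain q where q: "\<And>X m. run X q m = Some (?value X m - 1)"
    unfolding computable_in_def by auto
  show ?thesis
  proof (rule exI[of _ "Comp q (Pair (Pair Fst Snd) (Mu t))"], intro allI impI)
    fix G k n
    assume step: "\<forall>j<k. \<forall>n. run (G j) p n = Some (of_bool (G (Suc j) n))"
    let ?v = "\<lambda>s. lookup (approx_chain p (G 0) s k) n"
    obtain N where "agrees_below (Suc n) (approx_chain p (G 0) N k) (G k)"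
      using approx_chain_complete[OF step] by blast
    then have "1 - ?v N = 0" by (simp add: agrees_below_def)
    define s where "s = (LEAST s. 1 - ?v s = 0)"
    have s: "1 - ?v s = 0" unfolding s_def using \<open>1 - ?v N = 0\<close> by (rule LeastI)
    have "\<forall>r<s. 1 - ?v r > 0" unfolding s_def using not_less_Least by blast
    with s have "\<exists>m. 1 - ?v m = 0 \<and> (\<forall>r<m. 0 < 1 - ?v r)" by blast
    then have "run (G 0) (Mu t) (pr k n) = Some s"
      unfolding s_def by (simp add: t)
    moreover have "?v s = Suc (of_bool (G k n))"
      using s by (intro approx_chain_sound[OF step]) auto
    ultimately show "run (G 0) (Comp q (Pair (Pair Fst Snd) (Mu t))) (pr k n) =
        Some (of_bool (G k n))"
      by (simp add: q)
  qed
qed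


section \<open>Turing reducibility\<close>

lemma turing_le_via_godel:
  "turing_le_via y x (godel p) \<longleftrightarrow> (\<forall>n. run x p n = Some (of_bool (y n)))"
  by (auto simp: turing_le_via_def phi_def inv_f_f[OF inj_godel])

lemma uniform_reduction_iff:
  "(\<exists>e. \<forall>i\<in>A. turing_le_via (Y i) (X i) e) \<longleftrightarrow> computable_in A X (\<lambda>i n. of_bool (Y i n))"
proof -
  have "(\<exists>e. \<forall>i\<in>A. turing_le_via (Y i) (X i) e) \<longleftrightarrow> (\<exists>p. \<forall>i\<in>A. turing_le_via (Y i) (X i) (godel p))"
    by (metis surj_godel surjD)
  then show ?thesis unfolding turing_le_via_godel computable_in_def by blast
qed

lemma turing_le_iff: "y \<le>\<^sub>T x \<longleftrightarrow> computable_in UNIV (\<lambda>_::unit. x) (\<lambda>_ n. of_bool (y n))"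
  using uniform_reduction_iff[of "UNIV :: unit set" "\<lambda>_. y" "\<lambda>_. x"]
  by (simp add: turing_le_def)

lemma turing_le_trans: "z \<le>\<^sub>T y \<Longrightarrow> y \<le>\<^sub>T x \<Longrightarrow> z \<le>\<^sub>T x"
  unfolding turing_le_iff by (rule computable_in_trans)

definition uniformly_equivalent :: "'i set \<Rightarrow> ('i \<Rightarrow> cantor) \<Rightarrow> ('i \<Rightarrow> cantor) \<Rightarrow> bool" where
  "uniformly_equivalent A X Y \<longleftrightarrow>
    computable_in A X (\<lambda>i n. of_bool (Y i n)) \<and> computable_in A Y (\<lambda>i n. of_bool (X i n))"

lemma uniformly_equivalentD:
  assumes "uniformly_equivalent A X Y" "i \<in> A"
  shows "X i \<equiv>\<^sub>T Y i"
  using assms unfolding uniformly_equivalent_def uniform_reduction_iff[symmetric]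
    turing_equiv_def turing_le_def by blast

text \<open>
  Two equivalent families with common indices \<open>(i, j)\<close> have images with the common indices
  \<open>u (i, j)\<close>: since \<open>u\<close> is applied to a single argument, its own complexity does not
  matter.
\<close>

lemma uniformly_equivalent_image:
  assumes f: "uniformly_turing_invariant_on D f" and eq: "uniformly_equivalent A X Y"
    and "X ` A \<subseteq> D" "Y ` A \<subseteq> D"
  shows "uniformly_equivalent A (\<lambda>i. f (X i)) (\<lambda>i. f (Y i))"
proof -
  obtain u where u: "\<And>a b i j. a \<in> D \<Longrightarrow> b \<in> D \<Longrightarrow> turing_equiv_via a b (i, j) \<Longrightarrow>
      turing_equiv_via (f a) (f b) (u (i, j))"
    using f unfolding uniformly_turing_invariant_on_def by blast
  obtain i j where "\<forall>l\<in>A. turing_equiv_via (X l) (Y l) (i, j)"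
    using eq unfolding uniformly_equivalent_def uniform_reduction_iff[symmetric]
      turing_equiv_via_def by auto
  then have "\<forall>l\<in>A. turing_equiv_via (f (X l)) (f (Y l)) (u (i, j))"
    using assms(3,4) by (intro ballI u) auto
  then show ?thesis
    unfolding uniformly_equivalent_def uniform_reduction_iff[symmetric] turing_equiv_via_def by blast
qed

section \<open>Tagging a set with a number\<close>

definition tag :: "cantor \<Rightarrow> nat \<Rightarrow> cantor" where
  "tag z k n = (if psnd n = 0 then z (pfst n) else pfst n = k)"

lemma tag_0: "tag z k (pr n 0) = z n" and tag_1: "tag z k (pr n (Suc m)) \<longleftrightarrow> n = k"
  by (simp_all add: tag_def)

lemma computable_in_tag_set: "computable_in A (\<lambda>i. tag (z i) (k i)) (\<lambda>i n. of_bool (z i n))"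
proof -
  have "computable_in A (\<lambda>i. tag (z i) (k i)) (\<lambda>i n. of_bool (tag (z i) (k i) (pr n 0)))"
    by (intro computable_in_intros)
  then show ?thesis unfolding tag_0 .
qed

lemma computable_in_tag_number: "computable_in A (\<lambda>i. tag (z i) (k i)) (\<lambda>i n. k i)"
proof -
  have "computable_in A (\<lambda>i. tag (z i) (k i))
      (\<lambda>i n. LEAST m. 1 - of_bool (tag (z i) (k i) (pr m (Suc 0))) = (0::nat))"
  proof (rule computable_in_least)
    show "computable_in A (\<lambda>i. tag (z i) (k i))
      (\<lambda>i m. 1 - of_bool (tag (z i) (k i) (pr (psnd m) (Suc 0))))"
      by (intro computable_in_diff computable_in_intros)
    show "\<exists>m. 1 - of_bool (tag (z i) (k i) (pr m (Suc 0))) = (0::nat)" for i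
      by (simp add: tag_1)
  qed
  then show ?thesis
    by (rule computable_in_cong) (auto simp: tag_1 intro!: Least_equality)
qed

lemma computable_in_tag:
  assumes z: "computable_in A X (\<lambda>i n. of_bool (z i n))" and k: "computable_in A X (\<lambda>i n. k i)"
  shows "computable_in A X (\<lambda>i n. of_bool (tag (z i) (k i) n))"
proof -
  have "computable_in A X (\<lambda>i n. case psnd n of 0 \<Rightarrow> of_bool (z i (pfst n))
     | Suc v \<Rightarrow> (1 - (pfst n - k i)) - (k i - pfst n))"
    by (intro computable_in_intros computable_in_diff computable_in_comp[OF z] k)
  then show ?thesis
    by (rule computable_in_cong) (auto simp: tag_def split: nat.split)
qed

lemma tag_zero_equivalent: "uniformly_equivalent A z (\<lambda>i. tag (z i) 0)"
proof -
  have "computable_in A z (\<lambda>i n. of_bool (z i n))"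
    by (intro computable_in_intros)
  then show ?thesis
    unfolding uniformly_equivalent_def
    by (intro conjI computable_in_tag computable_in_const computable_in_tag_set)
qed

lemma tag_Suc_equivalent:
  "uniformly_equivalent A (\<lambda>i. tag (z i) (k i)) (\<lambda>i. tag (z i) (Suc (k i)))"
proof -
  have "computable_in A (\<lambda>i. tag (z i) (Suc (k i))) (\<lambda>i n. Suc (k i) - 1)"
    by (intro computable_in_diff computable_in_tag_number computable_in_const)
  then have "computable_in A (\<lambda>i. tag (z i) (Suc (k i))) (\<lambda>i n. k i)" by simp
  then show ?thesis
    unfolding uniformly_equivalent_def
    by (intro conjI computable_in_tag computable_in_Suc computable_in_tag_number computable_in_tag_set)
qed

definition switch :: "cantor \<Rightarrow> cantor \<Rightarrow> nat \<Rightarrow> cantor" where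
  "switch x y k = (if x k then y else x)"

text \<open>
  A number \<open>m\<close> with \<open>x m \<noteq> y m\<close> is built into the programs: the bit at \<open>m\<close> of
  \<open>switch x y k\<close> tells which of the two sets it is, so that \<open>x\<close> can be recovered from
  it in a way that does not depend on \<open>k\<close>.
\<close>

lemma tag_switch_equivalent:
  assumes "x \<equiv>\<^sub>T y" "x \<noteq> y"
  shows "uniformly_equivalent UNIV (tag x) (\<lambda>k. tag (switch x y k) k)"
proof -
  obtain m where m: "x m \<noteq> y m" using \<open>x \<noteq> y\<close> by blast
  have red: "computable_in A X (\<lambda>i n. of_bool (b n))"
    if "b \<le>\<^sub>T a" "computable_in A X (\<lambda>i n. of_bool (a n))" for A :: "nat set" and X a b
  proof -
    have "computable_in A (\<lambda>_. a) (\<lambda>i n. of_bool (b n))"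
      using that(1) unfolding turing_le_iff computable_in_def by simp
    with that(2) show ?thesis by (rule computable_in_trans)
  qed
  have xy: "x \<le>\<^sub>T y" "y \<le>\<^sub>T x" using assms(1) by (simp_all add: turing_equiv_def)
  have fwd_x: "computable_in A (tag x) (\<lambda>k n. of_bool (x n))" for A
    by (rule computable_in_tag_set[where z = "\<lambda>_. x" and k = "\<lambda>k. k"])
  have num: "computable_in UNIV (tag x) (\<lambda>k n. k)"
    by (rule computable_in_tag_number[where z = "\<lambda>_. x"])
  have "computable_in UNIV (tag x) (\<lambda>k n. of_bool (x k))"
    by (rule computable_in_comp[OF fwd_x num])
  then have "computable_in UNIV (tag x) (\<lambda>k n. if x k then of_bool (y n) else of_bool (x n))"
    by (rule computable_in_cases) (rule red[OF xy(2) fwd_x] fwd_x)+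
  then have "computable_in UNIV (tag x) (\<lambda>k n. of_bool (switch x y k n))"
    by (rule computable_in_cong) (simp add: switch_def)
  then have fwd: "computable_in UNIV (tag x) (\<lambda>k n. of_bool (tag (switch x y k) k n))"
    using num by (rule computable_in_tag)
  let ?Z = "\<lambda>k. tag (switch x y k) k"
  have z: "computable_in A ?Z (\<lambda>k n. of_bool (switch x y k n))" for A
    by (rule computable_in_tag_set)
  have bit: "computable_in UNIV ?Z (\<lambda>k n. of_bool (switch x y k m))"
    by (rule computable_in_comp[OF z computable_in_const])
  have "computable_in UNIV ?Z (\<lambda>k n. of_bool (x k))"
  proof (cases "y m")
    case True
    with m have "switch x y k m = x k" for k by (simp add: switch_def)
    with bit show ?thesis by simp
  next
    case False
    with m have sw: "switch x y k m = (\<not> x k)" for k by (simp add: switch_def)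
    have "computable_in UNIV ?Z (\<lambda>k n. 1 - of_bool (switch x y k m))"
      by (intro computable_in_diff computable_in_const bit)
    then show ?thesis by (rule computable_in_cong) (simp add: sw)
  qed
  \<comment> \<open>The two branches agree in value but are computed differently: by the reduction of \<open>x\<close> to
    \<open>y\<close>, which may diverge on \<open>x\<close>, and by copying the oracle.\<close>
  then have "computable_in UNIV ?Z (\<lambda>k n. if x k then of_bool (x n) else of_bool (x n))"
  proof (rule computable_in_cases)
    have "computable_in {k \<in> UNIV. x k} ?Z (\<lambda>k n. of_bool (y n))"
      using z by (rule computable_in_cong) (simp add: switch_def)
    then show "computable_in {k \<in> UNIV. x k} ?Z (\<lambda>k n. of_bool (x n))"
      by (rule red[OF xy(1)])
    show "computable_in {k \<in> UNIV. \<not> x k} ?Z (\<lambda>k n. of_bool (x n))"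
      using z by (rule computable_in_cong) (simp add: switch_def)
  qed
  then have "computable_in UNIV ?Z (\<lambda>k n. of_bool (x n))" by simp
  then have "computable_in UNIV ?Z (\<lambda>k n. of_bool (tag x k n))"
    by (rule computable_in_tag[where z = "\<lambda>_. x"]) (rule computable_in_tag_number)
  with fwd show ?thesis unfolding uniformly_equivalent_def by blast
qed

section \<open>Decoding the set from its image\<close>

theorem theorem2p2:
  fixes x :: cantor and f :: "cantor \<Rightarrow> cantor"
  assumes "uniformly_turing_invariant_on (turing_degree x) f"
  shows "x \<le>\<^sub>T f x \<or> (\<exists>c. \<forall>y\<in>turing_degree x. f y = c)"
proof (rule disjCI)
  assume nonconst: "\<not> (\<exists>c. \<forall>y\<in>turing_degree x. f y = c)"
  then obtain y where "y \<in> turing_degree x" and fy: "f y \<noteq> f x" by blast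
  then have "y \<equiv>\<^sub>T x" by (simp add: turing_degree_def)
  then have xy: "x \<equiv>\<^sub>T y" "x \<noteq> y" using fy by (auto simp: turing_equiv_def)
  let ?D = "turing_degree x"
  have equiv_trans: "a \<in> ?D" if "a \<equiv>\<^sub>T b" "b \<in> ?D" for a b
    using that turing_le_trans unfolding turing_degree_def turing_equiv_def by blast
  have "tag z k \<equiv>\<^sub>T z" for z k
    using computable_in_tag_set[of UNIV "\<lambda>_::unit. z" "\<lambda>_. k"]
      computable_in_tag[OF computable_in_query[OF computable_in_id] computable_in_const,
        of "UNIV :: unit set" "\<lambda>_. z" "k"]
    by (simp add: turing_equiv_def turing_le_iff)
  moreover have "x \<in> ?D"
    using xy(1) turing_le_trans unfolding turing_degree_def turing_equiv_def by blast
  ultimately have D: "x \<in> ?D" "y \<in> ?D" "tag x k \<in> ?D" "tag y k \<in> ?D"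
    "tag (switch x y k) k' \<in> ?D" for k k'
    using equiv_trans \<open>y \<in> ?D\<close> by (auto simp: switch_def)
  note image = uniformly_equivalent_image[OF assms]

  have "uniformly_equivalent ({x, y} \<times> UNIV)
      (\<lambda>i. f (tag (fst i) (snd i))) (\<lambda>i. f (tag (fst i) (Suc (snd i))))"
  proof (rule image[OF tag_Suc_equivalent])
    show "(\<lambda>i. tag (fst i) (snd i)) ` ({x, y} \<times> UNIV) \<subseteq> ?D"
      "(\<lambda>i. tag (fst i) (Suc (snd i))) ` ({x, y} \<times> UNIV) \<subseteq> ?D"
      using D(3,4) by (simp_all add: image_subset_iff)
  qed
  then obtain up down where
    "\<forall>i\<in>{x, y} \<times> UNIV. \<forall>n. run (f (tag (fst i) (snd i))) up n =
      Some (of_bool (f (tag (fst i) (Suc (snd i))) n))"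
    and "\<forall>i\<in>{x, y} \<times> UNIV. \<forall>n. run (f (tag (fst i) (Suc (snd i)))) down n =
      Some (of_bool (f (tag (fst i) (snd i)) n))"
    unfolding uniformly_equivalent_def computable_in_def by blast
  then have up: "run (f (tag x k)) up n = Some (of_bool (f (tag x (Suc k)) n))"
    and down: "z \<in> {x, y} \<Longrightarrow> run (f (tag z (Suc k))) down n = Some (of_bool (f (tag z k) n))"
    for z k n by (auto simp del: of_bool_eq_iff)
  have "uniformly_equivalent UNIV (\<lambda>k. f (tag x k)) (\<lambda>k. f (tag (switch x y k) k))"
    using D by (intro image tag_switch_equivalent xy) auto
  then obtain sw where
    sw: "\<And>k n. run (f (tag x k)) sw n = Some (of_bool (f (tag (switch x y k) k) n))"
    unfolding uniformly_equivalent_def computable_in_def by blast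
  have base: "uniformly_equivalent {x, y} f (\<lambda>z. f (tag z 0))"
    using D by (intro image tag_zero_equivalent) auto

  obtain P where P: "\<forall>G k n. (\<forall>j<k. \<forall>n. run (G j) up n = Some (of_bool (G (Suc j) n))) \<longrightarrow>
    run (G 0) P (pr k n) = Some (of_bool (G k n))"
    using iterate_reduction[of up] by blast
  have P: "run (f (tag x 0)) P (pr k n) = Some (of_bool (f (tag x k) n))" for k n
    using P[rule_format, where G = "\<lambda>k. f (tag x k)"] up by simp
  obtain Q where Q: "\<forall>G k n. (\<forall>j<k. \<forall>n. run (G j) down n = Some (of_bool (G (Suc j) n))) \<longrightarrow>
    run (G 0) Q (pr k n) = Some (of_bool (G k n))"
    using iterate_reduction[of down] by blast
  \<comment> \<open>The chain runs downwards, from the tag \<open>k\<close> to the tag \<open>0\<close>.\<close>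
  have Q: "run (f (tag z k)) Q (pr k n) = Some (of_bool (f (tag z 0) n))" if "z \<in> {x, y}" for z k n
  proof -
    have "run (f (tag z (k - j))) down n = Some (of_bool (f (tag z (k - Suc j)) n))" if "j < k" for j n
      using down[OF \<open>z \<in> {x, y}\<close>, of "k - Suc j" n] that by (simp add: Suc_diff_Suc)
    then show ?thesis using Q[rule_format, where G = "\<lambda>j. f (tag z (k - j))" and k = k and n = n] by simp
  qed
  let ?X = "f (tag x 0)"
  have "run ?X (psubst P sw) (pr k n) = Some (of_bool (f (tag (switch x y k) k) n))" for k n
    using run_psubst[OF P] sw by simp
  note run_psubst[OF this, of Q]
  \<comment> \<open>One \<open>k\<close> is the parameter of the oracle \<open>f (tag (switch x y k) k)\<close>, the other is the
    length of the descending chain.\<close>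
  then have R: "run ?X (psubst (psubst P sw) Q) (pr k (pr k n)) =
      Some (of_bool (f (tag (switch x y k) 0) n))" for k n
    using Q[of "switch x y k"] by (simp add: switch_def)

  have "f (tag x 0) \<noteq> f (tag y 0)"
  proof
    assume eq: "f (tag x 0) = f (tag y 0)"
    obtain p where "\<forall>z\<in>{x, y}. \<forall>n. run (f (tag z 0)) p n = Some (of_bool (f z n))"
      using base unfolding uniformly_equivalent_def computable_in_def by blast
    then have "Some (of_bool (f x n) :: nat) = Some (of_bool (f y n))" for n
      using eq by (metis insertCI)
    then have "f x n = f y n" for n by (simp add: of_bool_eq_iff)
    with fy show False by auto
  qed
  then obtain m where m: "f (tag x 0) m \<noteq> f (tag y 0) m" by blast
  obtain M where M: "run ?X M k = Some m" for k
    using computable_in_const[of UNIV "\<lambda>_::unit. ?X" m] unfolding computable_in_def by auto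
  let ?k = "Pair Fst Snd"
  have bit: "computable_in UNIV (\<lambda>_::unit. ?X) (\<lambda>_ k. of_bool (f (tag (switch x y k) 0) m))"
    by (rule computable_inI[where
          p = "Comp (psubst (psubst P sw) Q) (Pair ?k (Pair ?k M))"]) (simp add: M R)
  have "computable_in UNIV (\<lambda>_::unit. ?X) (\<lambda>_ k. of_bool (x k))"
  proof (cases "f (tag y 0) m")
    case True
    with m have "f (tag (switch x y k) 0) m = x k" for k by (simp add: switch_def)
    with bit show ?thesis by simp
  next
    case False
    with m have flip: "f (tag (switch x y k) 0) m = (\<not> x k)" for k by (simp add: switch_def)
    have "computable_in UNIV (\<lambda>_::unit. ?X) (\<lambda>_ k. 1 - of_bool (f (tag (switch x y k) 0) m))"
      by (intro computable_in_diff computable_in_const bit)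
    then show ?thesis by (rule computable_in_cong) (simp add: flip)
  qed
  then have "x \<le>\<^sub>T ?X" unfolding turing_le_iff .
  moreover have "?X \<le>\<^sub>T f x"
    using uniformly_equivalentD[OF base, of x] by (simp add: turing_equiv_def)
  ultimately show "x \<le>\<^sub>T f x" by (rule turing_le_trans)
qed

end
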